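(* In Specker's scenario, let $\mathcal{N}$ be the set of vectors $\vec v=(v^{ij}_{X_iX_j})$, $(ij)\in\{(12),(23),(13)\}$, $X_i,X_j\in\{0,1\}$, of $12$ real numbers satisfying the positivity, normalization and no-disturbance conditions. Then $\mathcal{N}$ is a convex polytope of (affine) dimension $6$ with exactly $12$ extreme points, namely: (a) the $8$ deterministic points, one for each $(x_1,x_2,x_3)\in\{0,1\}^3$, given by $v^{ij}_{X_iX_j}=\delta_{X_i,x_i}\delta_{X_j,x_j}$; (b) the following $4$ indeterministic points, where all components not listed are $0$: - $\vec v_8$: $v^{12}_{01}=v^{12}_{10}=v^{23}_{00}=v^{23}_{11}=v^{13}_{00}=v^{13}_{11}=\frac12$; - $\vec v_9$: $v^{12}_{00}=v^{12}_{11}=v^{23}_{01}=v^{23}_{10}=v^{13}_{00}=v^{13}_{11}=\frac12$; - $\vec v_{10}$: $v^{12}_{00}=v^{12}_{11}=v^{23}_{00}=v^{23}_{11}=v^{13}_{01}=v^{13}_{10}=\frac12$; - $\vec v_{11}$: $v^{12}_{01}=v^{12}_{10}=v^{23}_{01}=v^{23}_{10}=v^{13}_{01}=v^{13}_{10}=\frac12$. The $8$ deterministic points admit KS-noncontextual models, and the $4$ indeterministic points do not.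
   Context: Specker's scenario: three binary measurements $M_1,M_2,M_3$ with outcomes $X_i\in\{0,1\}$ that are pairwise jointly measurable; $v^{ij}_{X_iX_j}$ stands for the probability $p(X_iX_j|M_{ij};P)$ of obtaining $(X_i,X_j)$ in the joint measurement $M_{ij}$, $i<j$, for a given preparation $P$. Positivity: $v^{ij}_{X_iX_j}\ge 0$. Normalization: $\sum_{X_i,X_j}v^{ij}_{X_iX_j}=1$ for each $(ij)$. No-disturbance: for each $i\in\{1,2,3\}$ the marginal distribution of $X_i$ is the same in the two pairwise joint distributions in which it occurs, i.e. $\sum_{X_2}v^{12}_{X_1X_2}=\sum_{X_3}v^{13}_{X_1X_3}$ for each $X_1$, $\sum_{X_1}v^{12}_{X_1X_2}=\sum_{X_3}v^{23}_{X_2X_3}$ for each $X_2$, and $\sum_{X_1}v^{13}_{X_1X_3}=\sum_{X_2}v^{23}_{X_2X_3}$ for each $X_3$. A vector $\vec v\in\mathcal{N}$ admits a KS-noncontextual model if and only if there is a probability distribution $p(X_1,X_2,X_3)$ on $\{0,1\}^3$ whose two-variable marginals are the given ones: $v^{ij}_{X_iX_j}=\sum_{X_k,\,k\ne i,j}p(X_1,X_2,X_3)$ for each $(ij)$. *)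

theory Defs
  imports "HOL-Analysis.Analysis"
begin

datatype joint = M12 | M23 | M13

instance joint :: finite
proof
  have "(UNIV :: joint set) = {M12, M23, M13}"
    by (auto intro: joint.exhaust)
  then show "finite (UNIV :: joint set)"
    by (metis finite.emptyI finite_insert)
qed

text \<open>
  An outcome is an element of the two-element type \<^typ>\<open>2\<close>, whose elements are \<open>0\<close> and \<open>1\<close>.
  The component \<open>v $ (Mij, a, b)\<close> is the probability of \<open>(X\<^sub>i, X\<^sub>j) = (a, b)\<close> in the
  joint measurement \<open>Mij\<close>.
\<close>

type_synonym behaviour = "real ^ (joint \<times> 2 \<times> 2)"

definition positivity :: "behaviour \<Rightarrow> bool" where
  "positivity v \<longleftrightarrow> (\<forall>m a b. 0 \<le> v $ (m, a, b))"

definition normalization :: "behaviour \<Rightarrow> bool" where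
  "normalization v \<longleftrightarrow> (\<forall>m. (\<Sum>a\<in>UNIV. \<Sum>b\<in>UNIV. v $ (m, a, b)) = 1)"

definition no_disturbance :: "behaviour \<Rightarrow> bool" where
  "no_disturbance v \<longleftrightarrow>
     (\<forall>x1. (\<Sum>x2\<in>UNIV. v $ (M12, x1, x2)) = (\<Sum>x3\<in>UNIV. v $ (M13, x1, x3))) \<and>
     (\<forall>x2. (\<Sum>x1\<in>UNIV. v $ (M12, x1, x2)) = (\<Sum>x3\<in>UNIV. v $ (M23, x2, x3))) \<and>
     (\<forall>x3. (\<Sum>x1\<in>UNIV. v $ (M13, x1, x3)) = (\<Sum>x2\<in>UNIV. v $ (M23, x2, x3)))"

definition no_disturbance_set :: "behaviour set" where
  "no_disturbance_set = {v. positivity v \<and> normalization v \<and> no_disturbance v}"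

definition prob_distribution :: "(2 \<Rightarrow> 2 \<Rightarrow> 2 \<Rightarrow> real) \<Rightarrow> bool" where
  "prob_distribution p \<longleftrightarrow>
     (\<forall>x1 x2 x3. 0 \<le> p x1 x2 x3) \<and>
     (\<Sum>x1\<in>UNIV. \<Sum>x2\<in>UNIV. \<Sum>x3\<in>UNIV. p x1 x2 x3) = 1"

definition KS_noncontextual :: "behaviour \<Rightarrow> bool" where
  "KS_noncontextual v \<longleftrightarrow>
     (\<exists>p. prob_distribution p \<and>
        (\<forall>x1 x2. v $ (M12, x1, x2) = (\<Sum>x3\<in>UNIV. p x1 x2 x3)) \<and>
        (\<forall>x2 x3. v $ (M23, x2, x3) = (\<Sum>x1\<in>UNIV. p x1 x2 x3)) \<and>
        (\<forall>x1 x3. v $ (M13, x1, x3) = (\<Sum>x2\<in>UNIV. p x1 x2 x3)))"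

definition deterministic_point :: "2 \<times> 2 \<times> 2 \<Rightarrow> behaviour" where
  "deterministic_point = (\<lambda>(x1, x2, x3). vec_lambda (\<lambda>(m, a, b).
     case m of
       M12 \<Rightarrow> of_bool (a = x1) * of_bool (b = x2)
     | M23 \<Rightarrow> of_bool (a = x2) * of_bool (b = x3)
     | M13 \<Rightarrow> of_bool (a = x1) * of_bool (b = x3)))"

definition half_on :: "(joint \<times> 2 \<times> 2) set \<Rightarrow> behaviour" where
  "half_on S = (\<chi> i. if i \<in> S then 1/2 else 0)"

definition v8 :: behaviour where
  "v8 = half_on {(M12,0,1), (M12,1,0), (M23,0,0), (M23,1,1), (M13,0,0), (M13,1,1)}"

definition v9 :: behaviour where
  "v9 = half_on {(M12,0,0), (M12,1,1), (M23,0,1), (M23,1,0), (M13,0,0), (M13,1,1)}"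

definition v10 :: behaviour where
  "v10 = half_on {(M12,0,0), (M12,1,1), (M23,0,0), (M23,1,1), (M13,0,1), (M13,1,0)}"

definition v11 :: behaviour where
  "v11 = half_on {(M12,0,1), (M12,1,0), (M23,0,1), (M23,1,0), (M13,0,1), (M13,1,0)}"

end

(*
  Each indeterministic point w has a support S on which every deterministic point has mass at
  most 2. If a behaviour v has mass at most 2 on all four supports, these four inequalities
  together with positivity leave room for p(0,0,0), so v has a joint distribution and is a mixture
  of deterministic points. Otherwise v has mass M >= 2 on some S; subtracting (M - 2) w lands on a
  simplex spanned by six deterministic points, with the components of v off S as weights.
  So the polytope is the hull of the twelve points, and each of them is extreme because its
  support determines it. Expectations and correlators are six affine coordinates, and the uniform
  behaviour is interior in them, which gives the dimension.
*)
theory Submission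
  imports Defs
begin

section \<open>Bits, measurements and the linear constraints\<close>

lemma UNIV_two: "(UNIV :: 2 set) = {0, 1}"
proof -
  have "card {0, 1 :: 2} = CARD(2)" by simp
  then show ?thesis by (metis card_subset_eq finite subset_UNIV)
qed

lemma all_two: "(\<forall>x :: 2. P x) \<longleftrightarrow> P 0 \<and> P 1"
  using UNIV_two by (metis UNIV_I insertE singletonD)

lemma all_joint: "(\<forall>m. P m) \<longleftrightarrow> P M12 \<and> P M23 \<and> P M13"
  by (metis joint.exhaust)

lemma sum_two: "(\<Sum>x\<in>UNIV. f (x :: 2)) = f 0 + (f 1 :: 'a :: comm_monoid_add)"
  by (simp add: UNIV_two)

lemma sum_bits3:
  "(\<Sum>x\<in>UNIV. f (x :: 2 \<times> 2 \<times> 2)) = (\<Sum>a\<in>UNIV. \<Sum>b\<in>UNIV. \<Sum>c\<in>UNIV. f (a, b, c))"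
proof -
  have "(\<Sum>a\<in>UNIV. \<Sum>b\<in>UNIV. \<Sum>c\<in>UNIV. f (a, b, c)) = (\<Sum>a\<in>UNIV. \<Sum>y\<in>UNIV. f (a, y))"
    by (simp add: sum.cartesian_product UNIV_Times_UNIV[symmetric] del: UNIV_Times_UNIV)
  then show ?thesis
    by (simp add: sum.cartesian_product)
qed

lemmas behaviour_simps = all_joint all_two sum_two

lemma behaviour_eq_iff:
  "v = w \<longleftrightarrow> (\<forall>m a b. v $ (m, a, b) = (w :: behaviour) $ (m, a, b))"
  by (auto simp: vec_eq_iff)

lemmas no_disturbance_set_iff =
  no_disturbance_set_def positivity_def normalization_def no_disturbance_def

lemma no_disturbance_set_nonneg: "v \<in> no_disturbance_set \<Longrightarrow> 0 \<le> v $ i"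
  by (cases i) (simp add: no_disturbance_set_iff)

text \<open>The equality constraints are solved for six of the twelve components. Rewriting with the
  solution leaves six free components, so later identities reduce to linear arithmetic.\<close>

lemma no_disturbance_set_equations:
  assumes "v \<in> no_disturbance_set"
  shows "v $ (M12,1,1) = 1 - v $ (M12,0,0) - v $ (M12,0,1) - v $ (M12,1,0)"
    "v $ (M13,0,1) = v $ (M12,0,0) + v $ (M12,0,1) - v $ (M13,0,0)"
    "v $ (M13,1,1) = 1 - v $ (M12,0,0) - v $ (M12,0,1) - v $ (M13,1,0)"
    "v $ (M23,0,1) = v $ (M12,0,0) + v $ (M12,1,0) - v $ (M23,0,0)"
    "v $ (M23,1,0) = v $ (M13,0,0) + v $ (M13,1,0) - v $ (M23,0,0)"
    "v $ (M23,1,1) = 1 - v $ (M12,0,0) - v $ (M12,1,0) - v $ (M13,0,0) - v $ (M13,1,0) + v $ (M23,0,0)"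
proof -
  have "(\<forall>m. (\<Sum>a\<in>UNIV. \<Sum>b\<in>UNIV. v $ (m, a, b)) = 1) \<and> no_disturbance v"
    using assms by (simp add: no_disturbance_set_def normalization_def)
  note eqs = this[unfolded no_disturbance_def behaviour_simps]
  show "v $ (M12,1,1) = 1 - v $ (M12,0,0) - v $ (M12,0,1) - v $ (M12,1,0)"
    "v $ (M13,0,1) = v $ (M12,0,0) + v $ (M12,0,1) - v $ (M13,0,0)"
    "v $ (M13,1,1) = 1 - v $ (M12,0,0) - v $ (M12,0,1) - v $ (M13,1,0)"
    "v $ (M23,0,1) = v $ (M12,0,0) + v $ (M12,1,0) - v $ (M23,0,0)"
    "v $ (M23,1,0) = v $ (M13,0,0) + v $ (M13,1,0) - v $ (M23,0,0)"
    "v $ (M23,1,1) = 1 - v $ (M12,0,0) - v $ (M12,1,0) - v $ (M13,0,0) - v $ (M13,1,0) + v $ (M23,0,0)"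
    using eqs by linarith+
qed

lemma half_on_nth:
  "half_on S $ i = (if i \<in> S then 1/2 else 0)"
  by (simp add: half_on_def)

lemma deterministic_nth:
  "deterministic_point (x1, x2, x3) $ (m, a, b) = (case m of
       M12 \<Rightarrow> of_bool (a = x1) * of_bool (b = x2)
     | M23 \<Rightarrow> of_bool (a = x2) * of_bool (b = x3)
     | M13 \<Rightarrow> of_bool (a = x1) * of_bool (b = x3))"
  by (simp add: deterministic_point_def)

lemmas v_defs = v8_def v9_def v10_def v11_def

section \<open>The twelve points and convexity\<close>

definition vertices :: "behaviour set" where
  "vertices = range deterministic_point \<union> {v8, v9, v10, v11}"

lemma deterministic_in_no_disturbance_set: "deterministic_point x \<in> no_disturbance_set"
proof (cases x)
  case (fields a b c)
  \<comment> \<open>The bits are bound by quantifiers so that \<open>all_two\<close> can split the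
    claim into its eight cases.\<close>
  have "\<forall>a b c. deterministic_point (a, b, c) \<in> no_disturbance_set"
    by (simp add: no_disturbance_set_iff deterministic_nth behaviour_simps)
  then show ?thesis using fields by simp
qed

lemma indeterministic_in_no_disturbance_set: "{v8, v9, v10, v11} \<subseteq> no_disturbance_set"
  by (simp add: v_defs no_disturbance_set_iff half_on_nth behaviour_simps)

lemma convex_no_disturbance_set: "convex no_disturbance_set"
proof -
  have "convex {v. positivity v}"
    unfolding convex_def positivity_def by (auto intro!: add_nonneg_nonneg mult_nonneg_nonneg)
  moreover have "convex {v. normalization v}"
    unfolding convex_def normalization_def
    by (auto simp: sum.distrib sum_distrib_left[symmetric])
  moreover have "convex {v. no_disturbance v}"
    unfolding convex_def no_disturbance_def
    by (auto simp: sum.distrib sum_distrib_left[symmetric])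
  ultimately have "convex ({v. positivity v} \<inter> {v. normalization v} \<inter> {v. no_disturbance v})"
    by (intro convex_Int)
  moreover have "{v. positivity v} \<inter> {v. normalization v} \<inter> {v. no_disturbance v}
      = no_disturbance_set"
    by (auto simp: no_disturbance_set_def)
  ultimately show ?thesis by simp
qed

section \<open>Decomposition into the twelve points\<close>

text \<open>The components of a mixture of deterministic points are the pair marginals of its
  weights, so membership in the hull reduces to comparing marginals. One indeterministic point is
  allowed as an extra term.\<close>

lemma mixture_in_hull:
  fixes p :: "2 \<Rightarrow> 2 \<Rightarrow> 2 \<Rightarrow> real"
  assumes p: "\<And>a b c. 0 \<le> p a b c" and l: "0 \<le> l"
    and total: "(\<Sum>a\<in>UNIV. \<Sum>b\<in>UNIV. \<Sum>c\<in>UNIV. p a b c) + l = 1"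
    and w: "w \<in> {v8, v9, v10, v11}"
    and m12: "\<And>a b. v $ (M12, a, b) = (\<Sum>c\<in>UNIV. p a b c) + l * w $ (M12, a, b)"
    and m23: "\<And>b c. v $ (M23, b, c) = (\<Sum>a\<in>UNIV. p a b c) + l * w $ (M23, b, c)"
    and m13: "\<And>a c. v $ (M13, a, c) = (\<Sum>b\<in>UNIV. p a b c) + l * w $ (M13, a, c)"
  shows "v \<in> convex hull vertices"
proof -
  \<comment> \<open>\<open>None\<close> indexes the term of \<open>w\<close>, and
    \<open>Some\<close> the eight deterministic terms.\<close>
  let ?c = "\<lambda>i. case i of None \<Rightarrow> l | Some (a, b, c) \<Rightarrow> p a b c"
  let ?f = "\<lambda>i. case i of None \<Rightarrow> w | Some x \<Rightarrow> deterministic_point x"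
  have split: "(\<Sum>i\<in>UNIV. g i) = g None + (\<Sum>x\<in>UNIV. g (Some x))"
    for g :: "(2 \<times> 2 \<times> 2) option \<Rightarrow> 'b :: comm_monoid_add"
    by (simp add: UNIV_option_conv sum.reindex)
  have "(\<Sum>i\<in>UNIV. ?c i *\<^sub>R ?f i) \<in> convex hull vertices"
  proof (rule convex_sum)
    show "(\<Sum>i\<in>UNIV. ?c i) = 1"
      using total by (simp add: split sum_bits3)
    show "0 \<le> ?c i" for i
      using p l by (auto split: option.split)
    show "?f i \<in> convex hull vertices" for i
      using w by (intro hull_inc) (auto simp: vertices_def split: option.split)
  qed auto
  moreover have "(\<Sum>i\<in>UNIV. ?c i *\<^sub>R ?f i) = v"
    unfolding behaviour_eq_iff
    by (simp add: split sum_bits3 behaviour_simps m12 m23 m13 deterministic_nth)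
  ultimately show ?thesis by simp
qed

text \<open>Each set prescribes equal or opposite outcomes for every pair, with an odd number of
  opposite pairs. An assignment of three bits has an even number of opposite pairs, so it violates
  one or three of the prescriptions.\<close>

definition indeterministic_supports :: "(joint \<times> 2 \<times> 2) set set" where
  "indeterministic_supports =
    {{(M12,0,1), (M12,1,0), (M23,0,0), (M23,1,1), (M13,0,0), (M13,1,1)},
     {(M12,0,0), (M12,1,1), (M23,0,1), (M23,1,0), (M13,0,0), (M13,1,1)},
     {(M12,0,0), (M12,1,1), (M23,0,0), (M23,1,1), (M13,0,1), (M13,1,0)},
     {(M12,0,1), (M12,1,0), (M23,0,1), (M23,1,0), (M13,0,1), (M13,1,0)}}"

text \<open>
  Off the support \<open>S\<close> of an indeterministic point, every component extends to exactly one
  assignment that meets \<open>S\<close> in the other two measurements; that component is its weight.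
\<close>

definition residual :: "behaviour \<Rightarrow> (joint \<times> 2 \<times> 2) set \<Rightarrow> 2 \<Rightarrow> 2 \<Rightarrow> 2 \<Rightarrow> real" where
  "residual v S a b c =
     (if (M12, a, b) \<notin> S \<and> (M23, b, c) \<in> S \<and> (M13, a, c) \<in> S then v $ (M12, a, b) else 0) +
     (if (M12, a, b) \<in> S \<and> (M23, b, c) \<notin> S \<and> (M13, a, c) \<in> S then v $ (M23, b, c) else 0) +
     (if (M12, a, b) \<in> S \<and> (M23, b, c) \<in> S \<and> (M13, a, c) \<notin> S then v $ (M13, a, c) else 0)"

lemma contextual_in_hull:
  assumes v: "v \<in> no_disturbance_set" and S: "S \<in> indeterministic_supports"
    and large: "2 \<le> (\<Sum>i\<in>S. v $ i)"
  shows "v \<in> convex hull vertices"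
proof (rule mixture_in_hull[where w = "half_on S"])
  show "half_on S \<in> {v8, v9, v10, v11}"
    using S by (auto simp: indeterministic_supports_def v_defs)
  \<comment> \<open>Each measurement has total mass 1, so the six components off \<open>S\<close>
    sum to 3 minus the mass on \<open>S\<close>. The weight left over is that mass minus 2.\<close>
  let ?l = "(\<Sum>i\<in>S. v $ i) - 2"
  have pos: "0 \<le> v $ i" for i
    using v by (rule no_disturbance_set_nonneg)
  show "0 \<le> residual v S a b c" for a b c
    using pos by (simp add: residual_def)
  show "0 \<le> ?l" using large by simp
  note eqs = no_disturbance_set_equations[OF v]
  show "(\<Sum>a\<in>UNIV. \<Sum>b\<in>UNIV. \<Sum>c\<in>UNIV. residual v S a b c) + ?l = 1"
    using S unfolding indeterministic_supports_def by (elim insertE emptyE)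
      (simp add: behaviour_simps residual_def eqs)+
  \<comment> \<open>Off \<open>S\<close>, a single residual term reproduces the component. On
    \<open>S\<close>, the equality constraints balance the component against two residual terms and
    half of \<open>?l\<close>.\<close>
  have "\<forall>a b. v $ (M12, a, b) = (\<Sum>c\<in>UNIV. residual v S a b c) + ?l * half_on S $ (M12, a, b)"
    using S unfolding indeterministic_supports_def by (elim insertE emptyE)
      (simp add: behaviour_simps residual_def half_on_nth eqs field_simps)+
  then show "v $ (M12, a, b) = (\<Sum>c\<in>UNIV. residual v S a b c) + ?l * half_on S $ (M12, a, b)" for a b
    by blast
  have "\<forall>b c. v $ (M23, b, c) = (\<Sum>a\<in>UNIV. residual v S a b c) + ?l * half_on S $ (M23, b, c)"
    using S unfolding indeterministic_supports_def by (elim insertE emptyE)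
      (simp add: behaviour_simps residual_def half_on_nth eqs field_simps)+
  then show "v $ (M23, b, c) = (\<Sum>a\<in>UNIV. residual v S a b c) + ?l * half_on S $ (M23, b, c)" for b c
    by blast
  have "\<forall>a c. v $ (M13, a, c) = (\<Sum>b\<in>UNIV. residual v S a b c) + ?l * half_on S $ (M13, a, c)"
    using S unfolding indeterministic_supports_def by (elim insertE emptyE)
      (simp add: behaviour_simps residual_def half_on_nth eqs field_simps)+
  then show "v $ (M13, a, c) = (\<Sum>b\<in>UNIV. residual v S a b c) + ?l * half_on S $ (M13, a, c)" for a c
    by blast
qed

lemma KS_noncontextual_in_hull:
  assumes "KS_noncontextual v"
  shows "v \<in> convex hull vertices"
proof -
  obtain p where "prob_distribution p"
    "\<And>x1 x2. v $ (M12, x1, x2) = (\<Sum>x3\<in>UNIV. p x1 x2 x3)"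
    "\<And>x2 x3. v $ (M23, x2, x3) = (\<Sum>x1\<in>UNIV. p x1 x2 x3)"
    "\<And>x1 x3. v $ (M13, x1, x3) = (\<Sum>x2\<in>UNIV. p x1 x2 x3)"
    using assms unfolding KS_noncontextual_def by blast
  \<comment> \<open>\<open>v8\<close> is a placeholder with weight 0.\<close>
  then show ?thesis
    by (intro mixture_in_hull[of p 0 v8]) (auto simp: prob_distribution_def)
qed

text \<open>
  A joint distribution is determined by its marginals and the single number \<open>t = p 0 0 0\<close>.
  Of the 16 comparisons between a lower and an upper bound for \<open>t\<close>, 12 are the
  positivity conditions and 4 are the inequalities assumed here.
\<close>

lemma KS_noncontextual_if_small:
  assumes v: "v \<in> no_disturbance_set"
    and small: "\<forall>S\<in>indeterministic_supports. (\<Sum>i\<in>S. v $ i) \<le> 2"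
  shows "KS_noncontextual v"
proof -
  note eqs = no_disturbance_set_equations[OF v]
  have pos: "\<forall>m a b. 0 \<le> v $ (m, a, b)"
    using v by (simp add: no_disturbance_set_nonneg)
  note pos = pos[unfolded behaviour_simps eqs]
  \<comment> \<open>Once \<open>p 0 0 0 = t\<close> is fixed, the marginals force the other seven
    values: \<open>t\<close> minus a lower bound at assignments with an even number of ones, an
    upper bound minus \<open>t\<close> at the others.\<close>
  define l1 where "l1 = v $ (M12,0,0) - v $ (M13,0,1)"
  define l2 where "l2 = v $ (M12,0,0) - v $ (M23,0,1)"
  define l3 where "l3 = v $ (M13,0,0) - v $ (M23,1,0)"
  define u where "u = v $ (M12,0,0) + v $ (M23,1,1) - v $ (M13,0,1)"
  define t where "t = max (max 0 l1) (max l2 l3)"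
  have lower: "0 \<le> t" "l1 \<le> t" "l2 \<le> t" "l3 \<le> t"
    by (auto simp: t_def)
  \<comment> \<open>Each comparison pairs an even with an odd assignment, and \<open>t\<close>
    cancels in the sum of their values. If they differ in one bit, the sum is a component of
    \<open>v\<close>; if in all three, it is 1 minus half the mass of \<open>v\<close> on the
    support that both miss in every measurement.\<close>
  have upper: "t \<le> v $ (M12,0,0)" "t \<le> v $ (M13,0,0)" "t \<le> v $ (M23,0,0)" "t \<le> u"
    using pos small unfolding t_def l1_def l2_def l3_def u_def
    by (simp_all add: indeterministic_supports_def all_conj_distrib eqs)
  define p :: "2 \<Rightarrow> 2 \<Rightarrow> 2 \<Rightarrow> real" where "p = (\<lambda>a b c.
     if a = 0 then
       (if b = 0 then (if c = 0 then t else v $ (M12,0,0) - t)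
        else (if c = 0 then v $ (M13,0,0) - t else t - l1))
     else
       (if b = 0 then (if c = 0 then v $ (M23,0,0) - t else t - l2)
        else (if c = 0 then t - l3 else u - t)))"
  show ?thesis
    unfolding KS_noncontextual_def prob_distribution_def
    using lower upper
    by (intro exI[of _ p]) (simp add: p_def behaviour_simps l1_def l2_def l3_def u_def eqs)
qed

lemma no_disturbance_set_subset_hull: "no_disturbance_set \<subseteq> convex hull vertices"
proof
  fix v assume v: "v \<in> no_disturbance_set"
  show "v \<in> convex hull vertices"
  proof (cases "\<forall>S\<in>indeterministic_supports. (\<Sum>i\<in>S. v $ i) \<le> 2")
    case True
    then show ?thesis
      by (intro KS_noncontextual_in_hull KS_noncontextual_if_small v)
  next
    case False
    then show ?thesis
      using contextual_in_hull[OF v] by force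
  qed
qed

lemma no_disturbance_set_eq_hull: "no_disturbance_set = convex hull vertices"
proof
  show "convex hull vertices \<subseteq> no_disturbance_set"
    using deterministic_in_no_disturbance_set indeterministic_in_no_disturbance_set
    by (intro hull_minimal convex_no_disturbance_set) (auto simp: vertices_def)
qed (rule no_disturbance_set_subset_hull)

section \<open>Extremality\<close>

text \<open>A zero component of a proper mixture of nonnegative vectors is zero at both ends, so the
  ends of an open segment through \<open>w\<close> inherit its zeros and coincide.\<close>

lemma extreme_point_if_support_determines:
  assumes w: "w \<in> no_disturbance_set"
    and uniq: "\<And>u. u \<in> no_disturbance_set \<Longrightarrow> \<forall>i. w $ i = 0 \<longrightarrow> u $ i = 0 \<Longrightarrow> u = w"
  shows "w extreme_point_of no_disturbance_set"
  unfolding extreme_point_of_def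
proof (intro conjI w ballI notI)
  fix a b assume a: "a \<in> no_disturbance_set" and b: "b \<in> no_disturbance_set"
    and "w \<in> open_segment a b"
  then obtain t where ne: "a \<noteq> b" and t: "0 < t" "t < 1" and eq: "w = (1 - t) *\<^sub>R a + t *\<^sub>R b"
    by (auto simp: in_segment)
  have "a $ i = 0 \<and> b $ i = 0" if "w $ i = 0" for i
  proof -
    have "(1 - t) * a $ i + t * b $ i = 0"
      using that by (simp add: eq)
    then show ?thesis
      using t a b no_disturbance_set_nonneg[of a i] no_disturbance_set_nonneg[of b i]
      by (smt (verit) mult_nonneg_nonneg mult_eq_0_iff)
  qed
  then have "a = w" "b = w"
    using uniq a b by blast+
  then show False using ne by simp
qed

lemma deterministic_extreme: "deterministic_point x extreme_point_of no_disturbance_set"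
proof (rule extreme_point_if_support_determines[OF deterministic_in_no_disturbance_set])
  fix u assume u: "u \<in> no_disturbance_set"
    and supp: "\<forall>i. deterministic_point x $ i = 0 \<longrightarrow> u $ i = 0"
  have *: "\<forall>a b c. (\<forall>m k l. deterministic_point (a, b, c) $ (m, k, l) = 0 \<longrightarrow> u $ (m, k, l) = 0)
      \<longrightarrow> u = deterministic_point (a, b, c)"
    using u unfolding behaviour_eq_iff
    by (simp add: no_disturbance_set_iff deterministic_nth behaviour_simps)
  show "u = deterministic_point x"
    using * supp by (cases x) blast
qed

text \<open>With an odd number of opposite pairs, following the marginals once round the triangle
  exchanges the probabilities of 0 and 1. Both are then 1/2, and so is every surviving
  entry.\<close>

lemma indeterministic_extreme:
  assumes "w \<in> {v8, v9, v10, v11}"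
  shows "w extreme_point_of no_disturbance_set"
proof (rule extreme_point_if_support_determines)
  show "w \<in> no_disturbance_set" using assms indeterministic_in_no_disturbance_set by blast
  fix u assume u: "u \<in> no_disturbance_set" and supp: "\<forall>i. w $ i = 0 \<longrightarrow> u $ i = 0"
  have "\<forall>m k l. w $ (m, k, l) = 0 \<longrightarrow> u $ (m, k, l) = 0"
    using supp by blast
  then show "u = w"
    using assms u unfolding behaviour_eq_iff
    by (elim insertE emptyE)
      (simp add: no_disturbance_set_iff v_defs half_on_nth behaviour_simps)+
qed

lemma extreme_points_eq: "{v. v extreme_point_of no_disturbance_set} = vertices"
proof
  show "{v. v extreme_point_of no_disturbance_set} \<subseteq> vertices"
    unfolding no_disturbance_set_eq_hull using extreme_point_of_convex_hull by blast
  show "vertices \<subseteq> {v. v extreme_point_of no_disturbance_set}"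
    using deterministic_extreme indeterministic_extreme by (auto simp: vertices_def)
qed

section \<open>Noncontextual models and counting\<close>

lemma KS_noncontextual_deterministic: "KS_noncontextual (deterministic_point x)"
proof (cases x)
  case (fields a b c)
  then show ?thesis
    unfolding KS_noncontextual_def prob_distribution_def
    by (intro exI[of _ "\<lambda>i j k. of_bool (i = a) * of_bool (j = b) * of_bool (k = c)"])
      (simp add: deterministic_nth sum_distrib_left[symmetric] sum_distrib_right[symmetric])
qed

text \<open>A joint distribution would vanish wherever some pair leaves the support of
  \<open>w\<close>. By parity every assignment has such a pair, so the total would be 0 instead of
  1.\<close>

lemma not_KS_noncontextual_indeterministic:
  assumes "w \<in> {v8, v9, v10, v11}"
  shows "\<not> KS_noncontextual w"
proof
  assume "KS_noncontextual w"
  then obtain p where "prob_distribution p"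
    "\<forall>x1 x2. w $ (M12, x1, x2) = (\<Sum>x3\<in>UNIV. p x1 x2 x3)"
    "\<forall>x2 x3. w $ (M23, x2, x3) = (\<Sum>x1\<in>UNIV. p x1 x2 x3)"
    "\<forall>x1 x3. w $ (M13, x1, x3) = (\<Sum>x2\<in>UNIV. p x1 x2 x3)"
    unfolding KS_noncontextual_def by blast
  note lin = this[unfolded prob_distribution_def behaviour_simps]
  show False
    using assms
    by (elim insertE emptyE; insert lin) (simp add: v_defs half_on_nth)+
qed

lemma inj_deterministic_point: "inj deterministic_point"
proof (rule injI)
  fix x y assume eq: "deterministic_point x = deterministic_point y"
  obtain a b c where x: "x = (a, b, c)" by (cases x)
  obtain a' b' c' where y: "y = (a', b', c')" by (cases y)
  \<comment> \<open>The left-hand components are 1, which forces agreement of the first two and of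
    the last two bits.\<close>
  have "deterministic_point x $ (M12, a, b) = deterministic_point y $ (M12, a, b)"
       "deterministic_point x $ (M23, b, c) = deterministic_point y $ (M23, b, c)"
    using eq by simp_all
  then show "x = y"
    by (simp add: x y deterministic_nth of_bool_def split: if_splits)
qed

lemma card_deterministic: "card (range deterministic_point) = 8"
  using inj_deterministic_point by (simp add: card_image)

lemma card_indeterministic: "card {v8, v9, v10, v11} = 4"
proof -
  have "v8 \<noteq> v9" "v8 \<noteq> v10" "v8 \<noteq> v11" "v9 \<noteq> v10" "v9 \<noteq> v11" "v10 \<noteq> v11"
    unfolding behaviour_eq_iff by (simp_all add: v_defs half_on_nth behaviour_simps)
  then show ?thesis by simp
qed

lemma card_vertices: "card vertices = 12"
proof -
  have "range deterministic_point \<inter> {v8, v9, v10, v11} = {}"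
    using KS_noncontextual_deterministic not_KS_noncontextual_indeterministic by blast
  then show ?thesis
    unfolding vertices_def
    by (subst card_Un_disjoint) (simp_all add: card_deterministic card_indeterministic)
qed

section \<open>Affine dimension\<close>

text \<open>
  The coordinates are the expectations of the \<open>\<plusminus>1\<close>-valued observables \<open>(-1)^X\<^sub>i\<close>
  and of their pairwise products. The map gives the deviation from the uniform behaviour.
\<close>

definition bit_sign :: "2 \<Rightarrow> real" where
  "bit_sign x = (if x = 0 then 1 else -1)"

definition from_correlators :: "real \<times> real \<times> real \<times> real \<times> real \<times> real \<Rightarrow> behaviour" where
  "from_correlators = (\<lambda>(e1, e2, e3, e12, e23, e13). \<chi> i. case i of (m, a, b) \<Rightarrow>
     (case m of
        M12 \<Rightarrow> bit_sign a * e1 + bit_sign b * e2 + bit_sign a * bit_sign b * e12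
      | M23 \<Rightarrow> bit_sign a * e2 + bit_sign b * e3 + bit_sign a * bit_sign b * e23
      | M13 \<Rightarrow> bit_sign a * e1 + bit_sign b * e3 + bit_sign a * bit_sign b * e13) / 4)"

lemma from_correlators_nth:
  "from_correlators (e1, e2, e3, e12, e23, e13) $ (m, a, b) = (case m of
        M12 \<Rightarrow> bit_sign a * e1 + bit_sign b * e2 + bit_sign a * bit_sign b * e12
      | M23 \<Rightarrow> bit_sign a * e2 + bit_sign b * e3 + bit_sign a * bit_sign b * e23
      | M13 \<Rightarrow> bit_sign a * e1 + bit_sign b * e3 + bit_sign a * bit_sign b * e13) / 4"
  by (simp add: from_correlators_def)

lemma linear_from_correlators: "linear from_correlators"
proof (rule linearI)
  fix x y :: "real \<times> real \<times> real \<times> real \<times> real \<times> real" and r :: real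
  show "from_correlators (x + y) = from_correlators x + from_correlators y"
    unfolding behaviour_eq_iff
    by (cases x; cases y) (simp add: from_correlators_nth all_joint algebra_simps add_divide_distrib)
  show "from_correlators (r *\<^sub>R x) = r *\<^sub>R from_correlators x"
    unfolding behaviour_eq_iff
    by (cases x) (simp add: from_correlators_nth all_joint algebra_simps add_divide_distrib)
qed

lemma inj_from_correlators: "inj from_correlators"
  unfolding linear_injective_0[OF linear_from_correlators]
proof (intro allI impI)
  fix x assume "from_correlators x = 0"
  then show "x = 0"
    unfolding behaviour_eq_iff
    by (cases x) (simp add: from_correlators_nth behaviour_simps bit_sign_def zero_prod_def)
qed

definition uniform_behaviour :: behaviour where
  "uniform_behaviour = (\<chi> i. 1/4)"

definition correlator_set :: "(real \<times> real \<times> real \<times> real \<times> real \<times> real) set" where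
  "correlator_set = {x. \<forall>i. 0 \<le> (uniform_behaviour + from_correlators x) $ i}"

text \<open>Normalization and no-disturbance hold identically in these coordinates, so only
  positivity cuts out the set.\<close>

lemma no_disturbance_set_eq_image:
  "no_disturbance_set = (+) uniform_behaviour ` from_correlators ` correlator_set"
proof (intro equalityI subsetI)
  fix v assume v: "v \<in> no_disturbance_set"
  \<comment> \<open>An expectation is twice the probability of outcome 0 minus 1; a correlator is
    twice the probability of equal outcomes minus 1.\<close>
  define x where "x =
    (2 * (v $ (M12,0,0) + v $ (M12,0,1)) - 1, 2 * (v $ (M12,0,0) + v $ (M12,1,0)) - 1,
     2 * (v $ (M13,0,0) + v $ (M13,1,0)) - 1, 2 * (v $ (M12,0,0) + v $ (M12,1,1)) - 1,
     2 * (v $ (M23,0,0) + v $ (M23,1,1)) - 1, 2 * (v $ (M13,0,0) + v $ (M13,1,1)) - 1)"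
  have eq: "v = uniform_behaviour + from_correlators x"
    unfolding behaviour_eq_iff x_def
    by (simp add: no_disturbance_set_equations[OF v] behaviour_simps from_correlators_nth
        bit_sign_def uniform_behaviour_def field_simps)
  moreover have "x \<in> correlator_set"
    using v unfolding correlator_set_def mem_Collect_eq eq[symmetric] by (simp add: no_disturbance_set_nonneg)
  ultimately show "v \<in> (+) uniform_behaviour ` from_correlators ` correlator_set" by blast
next
  fix v assume "v \<in> (+) uniform_behaviour ` from_correlators ` correlator_set"
  then obtain x where x: "x \<in> correlator_set" and v: "v = uniform_behaviour + from_correlators x"
    by blast
  have "positivity v"
    using x by (simp add: v positivity_def correlator_set_def)
  moreover have "normalization v \<and> no_disturbance v"
    unfolding v
    by (cases x) (simp add: normalization_def no_disturbance_def behaviour_simps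
        from_correlators_nth bit_sign_def uniform_behaviour_def field_simps)
  ultimately show "v \<in> no_disturbance_set"
    by (simp add: no_disturbance_set_def)
qed

lemma aff_dim_no_disturbance_set: "aff_dim no_disturbance_set = 6"
proof -
  \<comment> \<open>Strict positivity gives an open neighbourhood of 0 inside
    \<open>correlator_set\<close>, which is therefore full-dimensional.\<close>
  let ?U = "{x. \<forall>i. 0 < (uniform_behaviour + from_correlators x) $ i}"
  have cont: "continuous_on UNIV (\<lambda>x. (uniform_behaviour + from_correlators x) $ i)" for i
    by (intro continuous_intros linear_continuous_on
        linear_from_correlators[unfolded linear_conv_bounded_linear])
  have "open (\<Inter>i. {x. 0 < (uniform_behaviour + from_correlators x) $ i})"
    by (intro open_INT finite ballI open_Collect_less continuous_on_const cont)
  moreover have "(\<Inter>i. {x. 0 < (uniform_behaviour + from_correlators x) $ i}) = ?U"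
    by auto
  ultimately have "open ?U" by simp
  moreover have "0 \<in> ?U"
    by (simp add: uniform_behaviour_def linear_0[OF linear_from_correlators])
  moreover have "?U \<subseteq> correlator_set"
    unfolding correlator_set_def using less_imp_le by blast
  ultimately have "interior correlator_set \<noteq> {}"
    using interior_maximal by blast
  then have "aff_dim correlator_set = 6"
    by (simp add: aff_dim_nonempty_interior)
  then show ?thesis
    by (simp add: no_disturbance_set_eq_image aff_dim_translation_eq
        aff_dim_injective_linear_image[OF linear_from_correlators inj_from_correlators])
qed

theorem mainTheorem3:
  shows "polytope no_disturbance_set \<and>
         aff_dim no_disturbance_set = 6 \<and>
         {v. v extreme_point_of no_disturbance_set} =
           range deterministic_point \<union> {v8, v9, v10, v11} \<and>
         card {v. v extreme_point_of no_disturbance_set} = 12 \<and>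
         card (range deterministic_point) = 8 \<and>
         card {v8, v9, v10, v11} = 4 \<and>
         (\<forall>x. KS_noncontextual (deterministic_point x)) \<and>
         (\<forall>v\<in>{v8, v9, v10, v11}. \<not> KS_noncontextual v)"
proof (intro conjI)
  have "finite vertices" by (simp add: vertices_def)
  then show "polytope no_disturbance_set"
    unfolding no_disturbance_set_eq_hull polytope_def by blast
qed (use aff_dim_no_disturbance_set extreme_points_eq card_vertices card_deterministic
    card_indeterministic KS_noncontextual_deterministic not_KS_noncontextual_indeterministic
    in \<open>auto simp: vertices_def\<close>)

end
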